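(* Let $\alpha,\beta>0$ and $\gamma=\min(\alpha,\beta)$. There exists a constant $C=C(\alpha,\beta,d)>0$ such that for all $\mu\in\mathcal{P}_\alpha(\mathbb{R}^d)$ and $\nu\in\mathcal{P}_\beta(\mathbb{R}^d)$, the convolution satisfies $\mu\ast\nu\in\mathcal{P}_\gamma(\mathbb{R}^d)$ and $$M_{\mu\ast\nu}(\gamma)\le C\left\{[M_\mu(\alpha)]^{\gamma/\alpha}+[M_\nu(\beta)]^{\gamma/\beta}\right\}.$$
   Context: Let $d\ge 1$ and let $|\cdot|$ denote the Euclidean norm on $\mathbb{R}^d$. $\mathcal{P}(\mathbb{R}^d)$ is the set of Borel probability measures on $\mathbb{R}^d$; for $\alpha>0$, $M_\mu(\alpha)=\int_{\mathbb{R}^d}|v|^\alpha d\mu(v)$ and $\mathcal{P}_\alpha(\mathbb{R}^d)=\{\mu\in\mathcal{P}(\mathbb{R}^d):M_\mu(\alpha)<\infty\}$. The convolution $\mu\ast\nu$ is the unique Borel measure with $\int f\,d(\mu\ast\nu)=\iint f(x+y)\,d\mu(x)\,d\nu(y)$ for every bounded continuous $f$ on $\mathbb{R}^d$. *)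

theory Defs
  imports "HOL-Probability.Probability"
begin

definition borel_prob_measures :: "'a::real_normed_vector measure set" where
  "borel_prob_measures = {\<mu>. prob_space \<mu> \<and> sets \<mu> = sets borel}"

text \<open>The moment is taken in the extended nonnegative reals, so that finiteness is a meaningful
  condition. Only exponents \<open>\<alpha> > 0\<close> are intended: for \<open>\<alpha> = 0\<close> the convention \<open>0 powr 0 = 0\<close>
  would leave out the mass at the origin.\<close>

definition moment :: "'a::real_normed_vector measure \<Rightarrow> real \<Rightarrow> ennreal" where
  "moment \<mu> \<alpha> = (\<integral>\<^sup>+v. ennreal (norm v powr \<alpha>) \<partial>\<mu>)"

definition prob_measures_moment :: "real \<Rightarrow> 'a::real_normed_vector measure set" where
  "prob_measures_moment \<alpha> = {\<mu> \<in> borel_prob_measures. moment \<mu> \<alpha> < \<infinity>}"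

text \<open>The library's convolution \<open>\<mu> \<star> \<nu>\<close> is the image of the product measure under addition. The next
  two lemmas show that it is the unique Borel measure determined by the integrals
  \<open>\<integral>\<integral> f (x + y) d\<mu>(x) d\<nu>(y)\<close> of bounded continuous functions \<open>f\<close>. In the uniqueness lemma
  finiteness is assumed because the Bochner integral of a non-integrable function is 0; a Borel
  measure that integrates the constant 1 to 1 is finite.\<close>

lemma integral_convolution_bounded_continuous:
  fixes \<mu> \<nu> :: "'a::ordered_euclidean_space measure" and f :: "'a \<Rightarrow> real"
  assumes "\<mu> \<in> borel_prob_measures" "\<nu> \<in> borel_prob_measures"
    and cont: "continuous_on UNIV f" and bdd: "bounded (range f)"
  shows "integrable (\<mu> \<star> \<nu>) f"
    and "(\<integral>z. f z \<partial>(\<mu> \<star> \<nu>)) = (\<integral>y. (\<integral>x. f (x + y) \<partial>\<mu>) \<partial>\<nu>)"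
proof -
  have [measurable_cong]: "sets \<mu> = sets borel" "sets \<nu> = sets borel"
    using assms by (auto simp: borel_prob_measures_def)
  interpret M: prob_space \<mu> using assms by (auto simp: borel_prob_measures_def)
  interpret N: prob_space \<nu> using assms by (auto simp: borel_prob_measures_def)
  interpret P: pair_prob_space \<mu> \<nu> ..
  have [measurable]: "f \<in> borel_measurable borel"
    using cont by (rule borel_measurable_continuous_onI)
  obtain B where B: "\<And>x. norm (f x) \<le> B"
    using bdd by (auto simp: bounded_iff)
  have int: "integrable (\<mu> \<Otimes>\<^sub>M \<nu>) (\<lambda>(x, y). f (x + y))"
    by (rule P.integrable_const_bound[where B = B]) (use B in auto)
  then show "integrable (\<mu> \<star> \<nu>) f"
    unfolding convolution_def by (subst integrable_distr_eq) (auto simp: case_prod_unfold)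
  have "(\<integral>z. f z \<partial>(\<mu> \<star> \<nu>)) = (\<integral>p. (case p of (x, y) \<Rightarrow> f (x + y)) \<partial>(\<mu> \<Otimes>\<^sub>M \<nu>))"
    unfolding convolution_def by (subst integral_distr) (auto simp: case_prod_unfold)
  also have "\<dots> = (\<integral>y. (\<integral>x. f (x + y) \<partial>\<mu>) \<partial>\<nu>)"
    using P.integral_snd[OF int] by simp
  finally show "(\<integral>z. f z \<partial>(\<mu> \<star> \<nu>)) = (\<integral>y. (\<integral>x. f (x + y) \<partial>\<mu>) \<partial>\<nu>)" .
qed

lemma measure_eqI_bounded_continuous:
  fixes M N :: "'a::euclidean_space measure"
  assumes "finite_measure M" "finite_measure N"
    and [measurable_cong]: "sets M = sets borel" "sets N = sets borel"
    and eq: "\<And>f :: 'a \<Rightarrow> real. continuous_on UNIV f \<Longrightarrow> bounded (range f) \<Longrightarrow>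
      (\<integral>z. f z \<partial>M) = (\<integral>z. f z \<partial>N)"
  shows "M = N"
proof -
  interpret M: finite_measure M by fact
  interpret N: finite_measure N by fact
  have closed_eq: "emeasure M A = emeasure N A" if A: "closed A" for A
  proof (cases "A = {}")
    case False
    define f :: "nat \<Rightarrow> 'a \<Rightarrow> real" where "f n x = max 0 (1 - real n * infdist x A)" for n x
    have cont: "continuous_on UNIV (f n)" for n
      unfolding f_def by (intro continuous_intros)
    have [measurable]: "f n \<in> borel_measurable borel" for n
      using cont by (rule borel_measurable_continuous_onI)
    have [measurable]: "A \<in> sets borel" using A by simp
    have bd: "norm (f n x) \<le> 1" for n x
      by (auto simp: f_def infdist_nonneg)
    then have bounded: "bounded (range (f n))" for n
      by (auto simp: bounded_iff)
    have lim: "(\<lambda>n. f n x) \<longlonglongrightarrow> indicator A x" for x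
    proof (cases "x \<in> A")
      case True
      then show ?thesis by (simp add: f_def)
    next
      case out: False
      then have "infdist x A > 0"
        using A False infdist_nonneg[of x A] in_closed_iff_infdist_zero[of A x] by fastforce
      then obtain m :: nat where m: "1 < real m * infdist x A"
        using reals_Archimedean3 by blast
      have "f n x = 0" if "n \<ge> m" for n
      proof -
        have "real m * infdist x A \<le> real n * infdist x A"
          using that by (intro mult_right_mono) (auto simp: infdist_nonneg)
        then show ?thesis using m by (simp add: f_def)
      qed
      then have "eventually (\<lambda>n. f n x = 0) sequentially"
        using eventually_sequentially by blast
      then have "(\<lambda>n. f n x) \<longlonglongrightarrow> 0" by (rule tendsto_eventually)
      then show ?thesis using out by simp
    qed
    have "(\<lambda>n. \<integral>x. f n x \<partial>M) \<longlonglongrightarrow> (\<integral>x. indicator A x \<partial>M)"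
      by (rule integral_dominated_convergence[where w = "\<lambda>_. 1"]) (use lim bd in auto)
    moreover have "(\<lambda>n. \<integral>x. f n x \<partial>N) \<longlonglongrightarrow> (\<integral>x. indicator A x \<partial>N)"
      by (rule integral_dominated_convergence[where w = "\<lambda>_. 1"]) (use lim bd in auto)
    ultimately have "(\<integral>x. indicator A x \<partial>M) = (\<integral>x. indicator A x \<partial>N :: real)"
      using eq[OF cont bounded] LIMSEQ_unique by auto
    moreover have "space M = UNIV" "space N = UNIV"
      using sets_eq_imp_space_eq[of M borel] sets_eq_imp_space_eq[of N borel] assms by auto
    ultimately show ?thesis
      by (simp add: M.emeasure_eq_measure N.emeasure_eq_measure)
  qed simp
  show "M = N"
  proof (rule measure_eqI_generator_eq[where E = "Collect closed" and \<Omega> = UNIV and A = "\<lambda>_. UNIV"])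
    show "Int_stable (Collect closed :: 'a set set)"
      by (auto simp: Int_stable_def)
    show "sets M = sigma_sets UNIV (Collect closed)" "sets N = sigma_sets UNIV (Collect closed)"
      using assms by (simp_all add: borel_eq_closed)
    show "emeasure M UNIV \<noteq> \<infinity>" for i :: nat
      by simp
  qed (use closed_eq in auto)
qed

end

theory Submission
  imports Defs
begin

text \<open>Two facts carry the estimate. Pointwise, \<open>norm (x + y)\<close> is at most twice the larger of
  \<open>norm x\<close> and \<open>norm y\<close>, so \<open>norm (x + y) powr \<gamma>\<close> is bounded by \<open>2 powr \<gamma>\<close> times
  \<open>norm x powr \<gamma> + norm y powr \<gamma>\<close>. Integrating this against the product of the two probability
  measures bounds the \<open>\<gamma>\<close>-moment of the convolution by \<open>2 powr \<gamma>\<close> times the sum of the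
  \<open>\<gamma>\<close>-moments of the factors (\<open>moment_convolution_le\<close>). Since \<open>\<gamma>\<close> is the smaller exponent,
  the monotonicity of power means on a probability space (\<open>moment_power_mean\<close>) then replaces the
  \<open>\<gamma>\<close>-moments by powers of the \<open>\<alpha>\<close>- and \<open>\<beta>\<close>-moments. The resulting constant
  is \<open>2 powr \<gamma>\<close>.\<close>

lemma norm_add_powr_le:
  fixes x y :: "'a::real_normed_vector"
  assumes "0 \<le> p"
  shows "norm (x + y) powr p \<le> 2 powr p * (norm x powr p + norm y powr p)"
proof -
  have "norm (x + y) powr p \<le> (2 * max (norm x) (norm y)) powr p"
    using norm_triangle_ineq[of x y] assms by (intro powr_mono2) auto
  also have "\<dots> = 2 powr p * max (norm x) (norm y) powr p"
    by (simp add: powr_mult)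
  also have "\<dots> \<le> 2 powr p * (norm x powr p + norm y powr p)"
    by (intro mult_left_mono) (auto simp: max_def)
  finally show ?thesis .
qed

text \<open>With \<open>r = p / q\<close> and \<open>s\<close> the \<open>q\<close>-moment, integrating Young's inequality
  \<open>t powr r * s powr (1 - r) \<le> r * t + (1 - r) * s\<close> at \<open>t = norm v powr q\<close> gives
  \<open>s powr (1 - r)\<close> times the \<open>p\<close>-moment on the left and exactly \<open>s\<close> on the right. Dividing by
  \<open>s powr (1 - r)\<close> needs \<open>s \<noteq> 0\<close>; if \<open>s = 0\<close>, then \<open>\<mu>\<close> is concentrated at the origin.\<close>

lemma moment_power_mean:
  fixes \<mu> :: "'a::real_normed_vector measure"
  assumes \<mu>: "\<mu> \<in> prob_measures_moment q" and "0 < p" "p \<le> q"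
  shows "moment \<mu> p \<le> ennreal (enn2real (moment \<mu> q) powr (p / q))"
proof -
  have [measurable_cong]: "sets \<mu> = sets borel" and fin: "moment \<mu> q < \<infinity>"
    using \<mu> by (auto simp: prob_measures_moment_def borel_prob_measures_def)
  interpret prob_space \<mu>
    using \<mu> by (auto simp: prob_measures_moment_def borel_prob_measures_def)
  define r where "r = p / q"
  define s where "s = enn2real (moment \<mu> q)"
  have r: "0 < r" "r \<le> 1" and p: "p = q * r"
    using assms by (auto simp: r_def)
  have s: "0 \<le> s" "moment \<mu> q = ennreal s"
    using fin by (auto simp: s_def less_top)
  show ?thesis
  proof (cases "s = 0")
    case True
    then have "(\<integral>\<^sup>+v. ennreal (norm v powr q) \<partial>\<mu>) = 0"
      using s by (simp add: moment_def)
    then have "AE v in \<mu>. norm v powr p = 0"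
      by (subst (asm) nn_integral_0_iff_AE) (auto simp: ennreal_eq_0_iff)
    then have "moment \<mu> p = 0"
      unfolding moment_def by (subst nn_integral_0_iff_AE) auto
    then show ?thesis by simp
  next
    case False
    with s have "0 < s" by simp
    have young: "norm v powr p \<le> s powr (r - 1) * (r * norm v powr q + (1 - r) * s)" for v :: 'a
    proof -
      have "(norm v powr q) powr r * s powr (1 - r) \<le> r * norm v powr q + (1 - r) * s"
        using r \<open>0 < s\<close> Youngs_inequality_0[of r "1 - r" "norm v powr q" s]
        by (cases "v = 0") auto
      then have "s powr (r - 1) * (norm v powr p * s powr (1 - r))
          \<le> s powr (r - 1) * (r * norm v powr q + (1 - r) * s)"
        by (intro mult_left_mono) (auto simp: p powr_powr)
      moreover have "s powr (r - 1) * s powr (1 - r) = 1"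
        using \<open>0 < s\<close> by (simp flip: powr_add)
      ultimately show ?thesis
        by (simp add: mult.left_commute)
    qed
    have "moment \<mu> p \<le> (\<integral>\<^sup>+v. ennreal (s powr (r - 1)) *
        (ennreal r * ennreal (norm v powr q) + ennreal ((1 - r) * s)) \<partial>\<mu>)"
      unfolding moment_def using young r \<open>0 < s\<close>
      by (intro nn_integral_mono) (simp flip: ennreal_mult ennreal_plus)
    also have "\<dots> = ennreal (s powr (r - 1)) * (ennreal r * moment \<mu> q + ennreal ((1 - r) * s))"
      unfolding moment_def
      by (simp add: nn_integral_cmult nn_integral_add emeasure_space_1)
    also have "\<dots> = ennreal (s powr (r - 1) * (r * s + (1 - r) * s))"
      using r \<open>0 < s\<close> by (simp add: s(2) flip: ennreal_mult ennreal_plus)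
    also have "s powr (r - 1) * (r * s + (1 - r) * s) = s powr (r - 1) * s powr 1"
      using \<open>0 < s\<close> by (simp add: algebra_simps)
    also have "\<dots> = s powr r"
      by (simp only: powr_add [symmetric]) simp
    finally show ?thesis
      by (simp add: r_def s_def)
  qed
qed

lemma moment_convolution_le:
  fixes \<mu> \<nu> :: "'a::ordered_euclidean_space measure"
  assumes "\<mu> \<in> borel_prob_measures" "\<nu> \<in> borel_prob_measures" and "0 \<le> p"
  shows "moment (\<mu> \<star> \<nu>) p \<le> ennreal (2 powr p) * (moment \<mu> p + moment \<nu> p)"
proof -
  have [measurable_cong]: "sets \<mu> = sets borel" "sets \<nu> = sets borel"
    using assms by (auto simp: borel_prob_measures_def)
  interpret M: prob_space \<mu> using assms by (auto simp: borel_prob_measures_def)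
  interpret N: prob_space \<nu> using assms by (auto simp: borel_prob_measures_def)
  have "moment (\<mu> \<star> \<nu>) p = (\<integral>\<^sup>+x. \<integral>\<^sup>+y. ennreal (norm (x + y) powr p) \<partial>\<nu> \<partial>\<mu>)"
    unfolding moment_def
    by (rule nn_integral_convolution)
      (use assms M.finite_measure_axioms N.finite_measure_axioms in
        \<open>auto simp: borel_prob_measures_def\<close>)
  also have "\<dots> \<le> (\<integral>\<^sup>+x. \<integral>\<^sup>+y. ennreal (2 powr p) *
      (ennreal (norm x powr p) + ennreal (norm y powr p)) \<partial>\<nu> \<partial>\<mu>)"
    using norm_add_powr_le[OF \<open>0 \<le> p\<close>]
    by (intro nn_integral_mono) (simp flip: ennreal_mult ennreal_plus)
  also have "\<dots> = ennreal (2 powr p) * (moment \<mu> p + moment \<nu> p)"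
    unfolding moment_def
    by (simp add: nn_integral_cmult nn_integral_add M.emeasure_space_1 N.emeasure_space_1)
  finally show ?thesis .
qed

lemma convolution_borel_prob_measures:
  fixes \<mu> \<nu> :: "'a::ordered_euclidean_space measure"
  assumes "\<mu> \<in> borel_prob_measures" "\<nu> \<in> borel_prob_measures"
  shows "(\<mu> \<star> \<nu>) \<in> borel_prob_measures"
proof -
  have [measurable_cong]: "sets \<mu> = sets borel" "sets \<nu> = sets borel"
    using assms by (auto simp: borel_prob_measures_def)
  interpret M: prob_space \<mu> using assms by (auto simp: borel_prob_measures_def)
  interpret N: prob_space \<nu> using assms by (auto simp: borel_prob_measures_def)
  interpret P: pair_prob_space \<mu> \<nu> ..
  have "prob_space (\<mu> \<star> \<nu>)"
    unfolding convolution_def by (rule P.prob_space_distr) measurable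
  then show ?thesis
    by (simp add: borel_prob_measures_def)
qed

theorem theorem6:
  fixes \<alpha> \<beta> \<gamma> :: real
  assumes "\<alpha> > 0" and "\<beta> > 0" and "\<gamma> = min \<alpha> \<beta>"
  shows "\<exists>C::real. C > 0 \<and>
    (\<forall>\<mu> \<in> (prob_measures_moment \<alpha> :: (real ^ 'd) measure set).
     \<forall>\<nu> \<in> (prob_measures_moment \<beta> :: (real ^ 'd) measure set).
       (\<mu> \<star> \<nu>) \<in> prob_measures_moment \<gamma> \<and>
       enn2real (moment (\<mu> \<star> \<nu>) \<gamma>) \<le>
         C * (enn2real (moment \<mu> \<alpha>) powr (\<gamma> / \<alpha>) + enn2real (moment \<nu> \<beta>) powr (\<gamma> / \<beta>)))"
proof (intro exI[of _ "2 powr \<gamma>"] conjI ballI)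
  show "(2::real) powr \<gamma> > 0"
    by simp
next
  fix \<mu> \<nu> :: "(real ^ 'd) measure"
  assume \<mu>: "\<mu> \<in> prob_measures_moment \<alpha>" and \<nu>: "\<nu> \<in> prob_measures_moment \<beta>"
  have \<gamma>: "0 < \<gamma>" "\<gamma> \<le> \<alpha>" "\<gamma> \<le> \<beta>"
    using assms by auto
  have prob: "\<mu> \<in> borel_prob_measures" "\<nu> \<in> borel_prob_measures"
    using \<mu> \<nu> by (auto simp: prob_measures_moment_def)
  define R where
    "R = 2 powr \<gamma> * (enn2real (moment \<mu> \<alpha>) powr (\<gamma> / \<alpha>) + enn2real (moment \<nu> \<beta>) powr (\<gamma> / \<beta>))"
  have "0 \<le> R"
    by (simp add: R_def)
  have "moment (\<mu> \<star> \<nu>) \<gamma> \<le> ennreal (2 powr \<gamma>) * (moment \<mu> \<gamma> + moment \<nu> \<gamma>)"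
    using moment_convolution_le[OF prob] \<gamma> by simp
  also have "\<dots> \<le> ennreal (2 powr \<gamma>) * (ennreal (enn2real (moment \<mu> \<alpha>) powr (\<gamma> / \<alpha>))
      + ennreal (enn2real (moment \<nu> \<beta>) powr (\<gamma> / \<beta>)))"
    using moment_power_mean[OF \<mu>] moment_power_mean[OF \<nu>] \<gamma>
    by (intro mult_left_mono add_mono) auto
  also have "\<dots> = ennreal R"
    by (simp add: R_def flip: ennreal_mult ennreal_plus)
  finally have le: "moment (\<mu> \<star> \<nu>) \<gamma> \<le> ennreal R" .
  then have "moment (\<mu> \<star> \<nu>) \<gamma> < \<infinity>"
    by (simp add: order_le_less_trans[OF le])
  then show "(\<mu> \<star> \<nu>) \<in> prob_measures_moment \<gamma>"
    using convolution_borel_prob_measures[OF prob] by (simp add: prob_measures_moment_def)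
  show "enn2real (moment (\<mu> \<star> \<nu>) \<gamma>) \<le>
      2 powr \<gamma> * (enn2real (moment \<mu> \<alpha>) powr (\<gamma> / \<alpha>) + enn2real (moment \<nu> \<beta>) powr (\<gamma> / \<beta>))"
    using enn2real_leI[OF \<open>0 \<le> R\<close> le] by (simp add: R_def)
qed

end
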